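(* Let $X$ be a (metrizable) foliated space, and let $\mathcal{F}$ be the decomposition of $X$ into leaves. If $\mathcal{F}$ is weakly equicontinuous, then $\mathcal{F}$ is $R$-closed and of characteristic $0$.
   Context: A foliated space is a metrizable space $X$ with an open cover by charts $\varphi_i\colon U_i\to B_i\times Z_i$ (homeomorphisms, with $B_i$ an open ball in $\mathbb{R}^n$ and $Z_i$ a metrizable space) whose transition maps locally have the form $(b,z)\mapsto(f(b,z),h(z))$. The plaques $\varphi_i^{-1}(B_i\times\{z\})$ glue together to form the leaves, which are the equivalence classes of points joined by finite chains of successively intersecting plaques. The leaves form a decomposition $\mathcal{F}$ of $X$ (a partition into non-empty subsets), and $\mathcal{F}(x)$ denotes the leaf containing $x$. For non-empty subsets $A,B$ of a metric space $(X,d)$, $d_H(A,B):=\inf\{\varepsilon>0\mid A\subseteq U_\varepsilon(B),\ B\subseteq U_\varepsilon(A)\}\in\mathbb{R}_{\ge 0}\sqcup\{\infty\}$, where $U_\varepsilon(C):=\bigcup_{x\in C}\{y\in X\mid d(y,x)<\varepsilon\}$ (with $\inf\emptyset=\infty$). $\mathcal{F}$ is weakly equicontinuous if there is a metric $d$ compatible with the topology of $X$ such that for every $\varepsilon>0$ there is $\delta>0$ with $d_H(\mathcal{F}(x),\mathcal{F}(y))<\varepsilon$ for all $x,y\in X$ with $d(x,y)<\delta$. $\mathcal{F}$ is $R$-closed if $\{(x,y)\in X\times X\mid y\in\overline{\mathcal{F}(x)}\}$ is closed in $X\times X$. The (bilateral) prolongation of $x$ is $D(x)=\{y\in X\mid\text{there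 are nets }(x_\alpha),(y_\alpha)\text{ in }X\text{ (with the same index set) such that } y_\alpha\in\mathcal{F}(x_\alpha),\ y_\alpha\to y,\ x_\alpha\to x\}$; $\mathcal{F}$ is of characteristic $0$ if $\overline{\mathcal{F}(x)}=D(x)$ for every $x\in X$. *)

theory Defs
  imports "HOL-Analysis.Analysis" "HOL-Library.Disjoint_Sets"
begin

section \<open>Foliated spaces\<close>

definition open_balls :: "nat \<Rightarrow> (nat \<Rightarrow> real) set set" where
  "open_balls n =
     {{x \<in> topspace (Euclidean_space n). sqrt (\<Sum>i<n. (x i - c i)\<^sup>2) < r} |c r.
        c \<in> topspace (Euclidean_space n) \<and> 0 < r}"

text \<open>
  A chart is a map \<open>chmap\<close> from \<open>chdom\<close> to \<open>chball \<times> chtrans\<close>. Different charts may have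
  different transversals; one carrier type \<open>'z\<close> for all of them is no restriction, because
  the charts can be transported to a sum type.
\<close>

record ('a, 'z) foliated_chart =
  chdom :: "'a set"
  chball :: "(nat \<Rightarrow> real) set"
  chtrans :: "'z topology"
  chmap :: "'a \<Rightarrow> (nat \<Rightarrow> real) \<times> 'z"

definition chart_codomain ::
    "nat \<Rightarrow> ('a, 'z) foliated_chart \<Rightarrow> ((nat \<Rightarrow> real) \<times> 'z) topology" where
  "chart_codomain n c =
     prod_topology (subtopology (Euclidean_space n) (chball c)) (chtrans c)"

definition is_foliated_chart :: "'a topology \<Rightarrow> nat \<Rightarrow> ('a, 'z) foliated_chart \<Rightarrow> bool" where
  "is_foliated_chart X n c \<longleftrightarrow>
     openin X (chdom c) \<and> chball c \<in> open_balls n \<and> metrizable_space (chtrans c) \<and>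
     homeomorphic_map (subtopology X (chdom c)) (chart_codomain n c) (chmap c)"

text \<open>
  The set \<open>W\<close> below can be shrunk to a product neighbourhood, on which \<open>f\<close> and \<open>h\<close> are
  automatically continuous because the transition map is.
\<close>

definition foliated_compatible ::
    "nat \<Rightarrow> ('a, 'z) foliated_chart \<Rightarrow> ('a, 'z) foliated_chart \<Rightarrow> bool" where
  "foliated_compatible n c c' \<longleftrightarrow>
     (\<forall>p \<in> chmap c ` (chdom c \<inter> chdom c').
        \<exists>W f h. openin (chart_codomain n c) W \<and> p \<in> W \<and> W \<subseteq> chmap c ` (chdom c \<inter> chdom c') \<and>
          (\<forall>(b, z) \<in> W. chmap c' (inv_into (chdom c) (chmap c) (b, z)) = (f (b, z), h z)))"

definition foliated_space :: "'a topology \<Rightarrow> nat \<Rightarrow> ('a, 'z) foliated_chart set \<Rightarrow> bool" where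
  "foliated_space X n \<A> \<longleftrightarrow>
     metrizable_space X \<and>
     (\<forall>c \<in> \<A>. is_foliated_chart X n c) \<and>
     (\<Union>c \<in> \<A>. chdom c) = topspace X \<and>
     (\<forall>c \<in> \<A>. \<forall>c' \<in> \<A>. foliated_compatible n c c')"

definition plaques :: "('a, 'z) foliated_chart set \<Rightarrow> 'a set set" where
  "plaques \<A> =
     {{p \<in> chdom c. chmap c p \<in> chball c \<times> {z}} |c z. c \<in> \<A> \<and> z \<in> topspace (chtrans c)}"

definition plaque_chain :: "('a, 'z) foliated_chart set \<Rightarrow> 'a \<Rightarrow> 'a \<Rightarrow> 'a set list \<Rightarrow> bool" where
  "plaque_chain \<A> x y Ps \<longleftrightarrow>
     Ps \<noteq> [] \<and> set Ps \<subseteq> plaques \<A> \<and> x \<in> hd Ps \<and> y \<in> last Ps \<and>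
     successively (\<lambda>P Q. P \<inter> Q \<noteq> {}) Ps"

definition same_leaf :: "('a, 'z) foliated_chart set \<Rightarrow> ('a \<times> 'a) set" where
  "same_leaf \<A> = {(x, y). \<exists>Ps. plaque_chain \<A> x y Ps}"

definition leaves :: "'a topology \<Rightarrow> ('a, 'z) foliated_chart set \<Rightarrow> 'a set set" where
  "leaves X \<A> = topspace X // same_leaf \<A>"

lemma equiv_same_leaf:
  assumes "foliated_space X n \<A>"
  shows "equiv (topspace X) (same_leaf \<A>)"
proof (rule equivI)
  have sub: "P \<subseteq> topspace X" if "P \<in> plaques \<A>" for P
    using that assms unfolding plaques_def foliated_space_def by auto
  have P: "x \<in> topspace X \<and> y \<in> topspace X" if "plaque_chain \<A> x y Ps" for x y Ps
    using that sub unfolding plaque_chain_def by (meson hd_in_set last_in_set subsetD)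
  show "same_leaf \<A> \<subseteq> topspace X \<times> topspace X"
    using P by (auto simp: same_leaf_def)
  show "refl_on (topspace X) (same_leaf \<A>)"
  proof (rule refl_onI)
    fix x assume "x \<in> topspace X"
    then obtain c where c: "c \<in> \<A>" "x \<in> chdom c"
      using assms unfolding foliated_space_def by (metis UN_E)
    have ch: "is_foliated_chart X n c"
      using assms c unfolding foliated_space_def by auto
    then have "chdom c \<subseteq> topspace X"
      by (simp add: is_foliated_chart_def openin_subset)
    with ch c have "chmap c x \<in> topspace (chart_codomain n c)"
      unfolding is_foliated_chart_def
      using homeomorphic_imp_surjective_map by fastforce
    then have z: "chmap c x \<in> chball c \<times> {snd (chmap c x)}" "snd (chmap c x) \<in> topspace (chtrans c)"
      by (auto simp: chart_codomain_def mem_Times_iff)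
    let ?P = "{p \<in> chdom c. chmap c p \<in> chball c \<times> {snd (chmap c x)}}"
    have "?P \<in> plaques \<A>" using c z unfolding plaques_def by blast
    moreover have "x \<in> ?P" using c z by auto
    ultimately have "plaque_chain \<A> x x [?P]"
      unfolding plaque_chain_def by simp
    then show "(x, x) \<in> same_leaf \<A>" unfolding same_leaf_def by blast
  qed
  show "sym (same_leaf \<A>)"
  proof (rule symI)
    fix x y assume "(x, y) \<in> same_leaf \<A>"
    then obtain Ps where "plaque_chain \<A> x y Ps" by (auto simp: same_leaf_def)
    then have "plaque_chain \<A> y x (rev Ps)"
      unfolding plaque_chain_def by (simp add: hd_rev last_rev successively_rev Int_commute)
    then show "(y, x) \<in> same_leaf \<A>" by (auto simp: same_leaf_def)
  qed
  show "trans (same_leaf \<A>)"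
  proof (rule transI)
    fix x y z assume "(x, y) \<in> same_leaf \<A>" "(y, z) \<in> same_leaf \<A>"
    then obtain Ps Qs where "plaque_chain \<A> x y Ps" "plaque_chain \<A> y z Qs"
      by (auto simp: same_leaf_def)
    then have "plaque_chain \<A> x z (Ps @ Qs)"
      unfolding plaque_chain_def by (auto simp: successively_append_iff)
    then show "(x, z) \<in> same_leaf \<A>" by (auto simp: same_leaf_def)
  qed
qed

lemma partition_on_leaves:
  "foliated_space X n \<A> \<Longrightarrow> partition_on (topspace X) (leaves X \<A>)"
  unfolding leaves_def by (rule partition_on_quotient[OF equiv_same_leaf])

section \<open>Properties of decompositions\<close>

definition part_of :: "'a set set \<Rightarrow> 'a \<Rightarrow> 'a set" where
  "part_of \<F> x = (THE L. L \<in> \<F> \<and> x \<in> L)"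

definition neighbourhood_of_radius ::
    "'a set \<Rightarrow> ('a \<Rightarrow> 'a \<Rightarrow> real) \<Rightarrow> real \<Rightarrow> 'a set \<Rightarrow> 'a set" where
  "neighbourhood_of_radius M d \<epsilon> C = (\<Union>x \<in> C. {y \<in> M. d y x < \<epsilon>})"

text \<open>In \<open>ereal\<close> the infimum of the empty set is \<open>\<infinity>\<close>.\<close>

definition Hausdorff_distance ::
    "'a set \<Rightarrow> ('a \<Rightarrow> 'a \<Rightarrow> real) \<Rightarrow> 'a set \<Rightarrow> 'a set \<Rightarrow> ereal" where
  "Hausdorff_distance M d A B =
     Inf {ereal \<epsilon> |\<epsilon>. 0 < \<epsilon> \<and> A \<subseteq> neighbourhood_of_radius M d \<epsilon> B \<and>
                          B \<subseteq> neighbourhood_of_radius M d \<epsilon> A}"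

definition weakly_equicontinuous :: "'a topology \<Rightarrow> 'a set set \<Rightarrow> bool" where
  "weakly_equicontinuous X \<F> \<longleftrightarrow>
     (\<exists>d. Metric_space (topspace X) d \<and> Metric_space.mtopology (topspace X) d = X \<and>
       (\<forall>\<epsilon>>0. \<exists>\<delta>>0. \<forall>x \<in> topspace X. \<forall>y \<in> topspace X. d x y < \<delta> \<longrightarrow>
          Hausdorff_distance (topspace X) d (part_of \<F> x) (part_of \<F> y) < ereal \<epsilon>))"

definition R_closed :: "'a topology \<Rightarrow> 'a set set \<Rightarrow> bool" where
  "R_closed X \<F> \<longleftrightarrow>
     closedin (prod_topology X X)
       {(x, y). x \<in> topspace X \<and> y \<in> topspace X \<and> y \<in> X closure_of (part_of \<F> x)}"

definition directed_preorder :: "'i set \<Rightarrow> ('i \<Rightarrow> 'i \<Rightarrow> bool) \<Rightarrow> bool" where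
  "directed_preorder I le \<longleftrightarrow>
     I \<noteq> {} \<and> (\<forall>\<alpha>\<in>I. le \<alpha> \<alpha>) \<and>
     (\<forall>\<alpha>\<in>I. \<forall>\<beta>\<in>I. \<forall>\<gamma>\<in>I. le \<alpha> \<beta> \<longrightarrow> le \<beta> \<gamma> \<longrightarrow> le \<alpha> \<gamma>) \<and>
     (\<forall>\<alpha>\<in>I. \<forall>\<beta>\<in>I. \<exists>\<gamma>\<in>I. le \<alpha> \<gamma> \<and> le \<beta> \<gamma>)"

definition net_converges ::
    "'a topology \<Rightarrow> 'i set \<Rightarrow> ('i \<Rightarrow> 'i \<Rightarrow> bool) \<Rightarrow> ('i \<Rightarrow> 'a) \<Rightarrow> 'a \<Rightarrow> bool" where
  "net_converges X I le xs x \<longleftrightarrow>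
     x \<in> topspace X \<and>
     (\<forall>U. openin X U \<and> x \<in> U \<longrightarrow> (\<exists>\<alpha>\<in>I. \<forall>\<beta>\<in>I. le \<alpha> \<beta> \<longrightarrow> xs \<beta> \<in> U))"

definition prolongation_nets :: "'a topology \<Rightarrow> 'a set set \<Rightarrow> 'a \<Rightarrow> 'a \<Rightarrow>
    'i set \<Rightarrow> ('i \<Rightarrow> 'i \<Rightarrow> bool) \<Rightarrow> ('i \<Rightarrow> 'a) \<Rightarrow> ('i \<Rightarrow> 'a) \<Rightarrow> bool" where
  "prolongation_nets X \<F> x y I le xs ys \<longleftrightarrow>
     directed_preorder I le \<and>
     (\<forall>\<alpha>\<in>I. xs \<alpha> \<in> topspace X \<and> ys \<alpha> \<in> topspace X \<and> ys \<alpha> \<in> part_of \<F> (xs \<alpha>)) \<and>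
     net_converges X I le ys y \<and> net_converges X I le xs x"

text \<open>
  HOL cannot quantify over index types inside a definition, so the index sets of the nets are
  subsets of one type, large enough for pairs of neighbourhoods. The lemma
  \<open>prolongationI\<close> shows that nets over any other index type give nothing new.
\<close>

definition prolongation :: "'a topology \<Rightarrow> 'a set set \<Rightarrow> 'a \<Rightarrow> 'a set" where
  "prolongation X \<F> x =
     {y \<in> topspace X. \<exists>(I :: ('a set \<times> 'a set) set) le xs ys. prolongation_nets X \<F> x y I le xs ys}"

definition characteristic_0 :: "'a topology \<Rightarrow> 'a set set \<Rightarrow> bool" where
  "characteristic_0 X \<F> \<longleftrightarrow>
     (\<forall>x \<in> topspace X. X closure_of (part_of \<F> x) = prolongation X \<F> x)"

lemma prolongationI:
  fixes I :: "'i set"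
  assumes "prolongation_nets X \<F> x y I le xs ys"
  shows "y \<in> prolongation X \<F> x"
proof -
  define J where "J = {(U, V). openin X U \<and> x \<in> U \<and> openin X V \<and> y \<in> V}"
  define leJ :: "'a set \<times> 'a set \<Rightarrow> 'a set \<times> 'a set \<Rightarrow> bool"
    where "leJ = (\<lambda>p q. fst q \<subseteq> fst p \<and> snd q \<subseteq> snd p)"
  have xy: "x \<in> topspace X" "y \<in> topspace X"
    using assms unfolding prolongation_nets_def net_converges_def by auto
  have "\<exists>\<alpha>\<in>I. xs \<alpha> \<in> fst p \<and> ys \<alpha> \<in> snd p" if p: "p \<in> J" for p
  proof -
    obtain \<alpha> \<beta> where "\<alpha> \<in> I" "\<beta> \<in> I" "\<forall>\<gamma>\<in>I. le \<alpha> \<gamma> \<longrightarrow> xs \<gamma> \<in> fst p"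
      "\<forall>\<gamma>\<in>I. le \<beta> \<gamma> \<longrightarrow> ys \<gamma> \<in> snd p"
      using p assms unfolding prolongation_nets_def net_converges_def J_def
      by (metis (no_types, lifting) case_prod_unfold mem_Collect_eq)
    moreover obtain \<gamma> where "\<gamma> \<in> I" "le \<alpha> \<gamma>" "le \<beta> \<gamma>"
      using assms calculation(1,2) unfolding prolongation_nets_def directed_preorder_def by blast
    ultimately show ?thesis by blast
  qed
  then obtain k where k: "\<And>p. p \<in> J \<Longrightarrow> k p \<in> I \<and> xs (k p) \<in> fst p \<and> ys (k p) \<in> snd p"
    by metis
  have T: "(topspace X, topspace X) \<in> J" using xy by (simp add: J_def)
  have "\<exists>r\<in>J. leJ p r \<and> leJ q r" if "p \<in> J" "q \<in> J" for p q
    by (rule bexI[where x = "(fst p \<inter> fst q, snd p \<inter> snd q)"])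
      (use that in \<open>auto simp: J_def leJ_def\<close>)
  with T have dir: "directed_preorder J leJ"
    unfolding directed_preorder_def by (auto simp: leJ_def)
  have "net_converges X J leJ (\<lambda>p. xs (k p)) x"
    unfolding net_converges_def
  proof (intro conjI allI impI)
    fix U assume U: "openin X U \<and> x \<in> U"
    show "\<exists>p\<in>J. \<forall>q\<in>J. leJ p q \<longrightarrow> xs (k q) \<in> U"
      by (rule bexI[where x = "(U, topspace X)"]) (use U xy k in \<open>auto simp: J_def leJ_def\<close>)
  qed (rule xy)
  moreover have "net_converges X J leJ (\<lambda>p. ys (k p)) y"
    unfolding net_converges_def
  proof (intro conjI allI impI)
    fix V assume V: "openin X V \<and> y \<in> V"
    show "\<exists>p\<in>J. \<forall>q\<in>J. leJ p q \<longrightarrow> ys (k q) \<in> V"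
      by (rule bexI[where x = "(topspace X, V)"]) (use V xy k in \<open>auto simp: J_def leJ_def\<close>)
  qed (rule xy)
  ultimately have "prolongation_nets X \<F> x y J leJ (\<lambda>p. xs (k p)) (\<lambda>p. ys (k p))"
    using dir k assms unfolding prolongation_nets_def by blast
  then show ?thesis using xy unfolding prolongation_def by blast
qed

end

(*
  The prolongation relation is the closure of the graph of "y lies in the part of x". Hence a
  decomposition of characteristic 0 is R-closed, as {(x, y). y \<in> closure of F(x)} is
  then itself the closure of a set. If y' \<in> F(x') with x' near x and y' near y, weak
  equicontinuity puts y' near F(x); so y lies in the closure of F(x), which gives
  characteristic 0.
*)
theory Submission
  imports Defs
begin

text \<open>Disjointness makes the part containing \<open>x\<close> unique, so the definite
  description in \<open>part_of\<close> denotes a genuine member of \<open>\<F>\<close>.\<close>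

lemma part_of_subset:
  assumes "partition_on S \<F>" "x \<in> S"
  shows "part_of \<F> x \<subseteq> S"
proof -
  have S: "S = \<Union>\<F>"
    using assms(1) by (rule partition_onD1)
  obtain L where L: "L \<in> \<F>" "x \<in> L"
    using assms(2) unfolding S by (rule UnionE)
  have "L' = L" if "L' \<in> \<F> \<and> x \<in> L'" for L'
    using disjointD[OF partition_onD2[OF assms(1)] _ L(1)] L(2) that by blast
  with L have "part_of \<F> x = L"
    unfolding part_of_def by (metis (mono_tags, lifting) the_equality)
  then show ?thesis
    unfolding S using L(1) by (simp add: Union_upper)
qed

text \<open>For a partition this is its equivalence relation. \<open>part_of\<close> is unspecified
  at points that lie in no part, hence the explicit restriction to the space.\<close>

definition part_graph :: "'a topology \<Rightarrow> 'a set set \<Rightarrow> ('a \<times> 'a) set" where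
  "part_graph X \<F> = {(x, y). x \<in> topspace X \<and> y \<in> topspace X \<and> y \<in> part_of \<F> x}"

text \<open>Open rectangles form a base of the product topology, so the closure can be tested on
  them.\<close>

lemma closure_part_graph_iff:
  "(x, y) \<in> prod_topology X X closure_of part_graph X \<F> \<longleftrightarrow>
     x \<in> topspace X \<and> y \<in> topspace X \<and>
     (\<forall>U V. openin X U \<and> x \<in> U \<and> openin X V \<and> y \<in> V \<longrightarrow> (\<exists>x'\<in>U. \<exists>y'\<in>V. y' \<in> part_of \<F> x'))"
  (is "?L \<longleftrightarrow> ?R")
proof
  assume L: ?L
  then have xy: "x \<in> topspace X" "y \<in> topspace X"
    by (auto simp: in_closure_of)
  have "\<exists>x'\<in>U. \<exists>y'\<in>V. y' \<in> part_of \<F> x'"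
    if "openin X U" "x \<in> U" "openin X V" "y \<in> V" for U V
  proof -
    have "openin (prod_topology X X) (U \<times> V)" "(x, y) \<in> U \<times> V"
      using that by (auto simp: openin_prod_Times_iff)
    with L obtain p where "p \<in> part_graph X \<F>" "p \<in> U \<times> V"
      unfolding in_closure_of by meson
    then show ?thesis
      by (auto simp: part_graph_def)
  qed
  with xy show ?R by blast
next
  assume R: ?R
  have "\<exists>p. p \<in> part_graph X \<F> \<and> p \<in> T"
    if T: "openin (prod_topology X X) T" "(x, y) \<in> T" for T
  proof -
    obtain U V where UV: "openin X U" "openin X V" "x \<in> U" "y \<in> V" "U \<times> V \<subseteq> T"
      using T unfolding openin_prod_topology_alt by meson
    then obtain x' y' where "x' \<in> U" "y' \<in> V" "y' \<in> part_of \<F> x'"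
      using R by meson
    \<comment> \<open>Open sets lie in the space, which supplies the restriction built into
      \<open>part_graph\<close>.\<close>
    moreover have "U \<subseteq> topspace X" "V \<subseteq> topspace X"
      using UV openin_subset by auto
    ultimately show ?thesis
      using UV by (intro exI[of _ "(x', y')"]) (auto simp: part_graph_def)
  qed
  with R show ?L
    by (auto simp: in_closure_of)
qed

text \<open>The closure of a set consists of the limits of nets in it, and a net in the product
  converges exactly when both coordinate nets do.\<close>

lemma prolongation_iff_closure_part_graph:
  "y \<in> prolongation X \<F> x \<longleftrightarrow> (x, y) \<in> prod_topology X X closure_of part_graph X \<F>"
proof
  assume "y \<in> prolongation X \<F> x"
  then obtain I :: "('a set \<times> 'a set) set" and le xs ys
    where nets: "prolongation_nets X \<F> x y I le xs ys"
    unfolding prolongation_def by blast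
  then have xy: "x \<in> topspace X" "y \<in> topspace X"
    unfolding prolongation_nets_def net_converges_def by auto
  have "\<exists>x'\<in>U. \<exists>y'\<in>V. y' \<in> part_of \<F> x'"
    if UV: "openin X U" "x \<in> U" "openin X V" "y \<in> V" for U V
  proof -
    have "\<exists>\<alpha>\<in>I. \<forall>\<gamma>\<in>I. le \<alpha> \<gamma> \<longrightarrow> xs \<gamma> \<in> U"
      using nets UV unfolding prolongation_nets_def net_converges_def by blast
    then obtain \<alpha> where \<alpha>: "\<alpha> \<in> I" "\<And>\<gamma>. \<gamma> \<in> I \<Longrightarrow> le \<alpha> \<gamma> \<Longrightarrow> xs \<gamma> \<in> U"
      by blast
    have "\<exists>\<beta>\<in>I. \<forall>\<gamma>\<in>I. le \<beta> \<gamma> \<longrightarrow> ys \<gamma> \<in> V"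
      using nets UV unfolding prolongation_nets_def net_converges_def by blast
    then obtain \<beta> where \<beta>: "\<beta> \<in> I" "\<And>\<gamma>. \<gamma> \<in> I \<Longrightarrow> le \<beta> \<gamma> \<Longrightarrow> ys \<gamma> \<in> V"
      by blast
    \<comment> \<open>Directedness yields one index beyond both \<alpha> and \<beta>, at which
      \<open>xs\<close> is in \<open>U\<close> and \<open>ys\<close> is in \<open>V\<close>
      simultaneously.\<close>
    have "\<forall>\<alpha>\<in>I. \<forall>\<beta>\<in>I. \<exists>\<gamma>\<in>I. le \<alpha> \<gamma> \<and> le \<beta> \<gamma>"
      using nets unfolding prolongation_nets_def directed_preorder_def by (elim conjE)
    with \<alpha>(1) \<beta>(1) obtain \<gamma> where \<gamma>: "\<gamma> \<in> I" "le \<alpha> \<gamma>" "le \<beta> \<gamma>"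
      by blast
    moreover have "ys \<gamma> \<in> part_of \<F> (xs \<gamma>)"
      using nets \<gamma>(1) unfolding prolongation_nets_def by simp
    ultimately show ?thesis
      using \<alpha>(2) \<beta>(2) by blast
  qed
  with xy show "(x, y) \<in> prod_topology X X closure_of part_graph X \<F>"
    unfolding closure_part_graph_iff by blast
next
  assume cl: "(x, y) \<in> prod_topology X X closure_of part_graph X \<F>"
  \<comment> \<open>The neighbourhoods of \<open>(x, y)\<close>, ordered by reverse inclusion, index
    the net. Their type differs from the index type fixed in \<open>prolongation\<close>;
    \<open>prolongationI\<close> bridges this at the end.\<close>
  define I where "I = {T. openin (prod_topology X X) T \<and> (x, y) \<in> T}"
  have xy: "x \<in> topspace X" "y \<in> topspace X"
    using cl by (auto simp: in_closure_of)
  have "\<exists>p. p \<in> part_graph X \<F> \<and> p \<in> T" if "T \<in> I" for T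
    using cl that unfolding in_closure_of I_def by blast
  then obtain k where k: "\<And>T. T \<in> I \<Longrightarrow> k T \<in> part_graph X \<F> \<and> k T \<in> T"
    by metis
  have top: "topspace (prod_topology X X) \<in> I"
    unfolding I_def using xy openin_topspace[of "prod_topology X X"] by simp
  have "S \<inter> T \<in> I" if "S \<in> I" "T \<in> I" for S T
    using that by (auto simp: I_def)
  with top have dir: "directed_preorder I (\<lambda>S T. T \<subseteq> S)"
    unfolding directed_preorder_def by (blast intro: Int_lower1 Int_lower2)
  \<comment> \<open>Stated for any continuous \<open>f\<close>, so that both projections are
    instances.\<close>
  have conv: "net_converges X I (\<lambda>S T. T \<subseteq> S) (\<lambda>T. f (k T)) (f (x, y))"
    if f: "continuous_map (prod_topology X X) X f" for f
    unfolding net_converges_def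
  proof (intro conjI allI impI)
    show "f (x, y) \<in> topspace X"
      using continuous_map_image_subset_topspace[OF f] xy by auto
    fix U assume U: "openin X U \<and> f (x, y) \<in> U"
    show "\<exists>S\<in>I. \<forall>T\<in>I. T \<subseteq> S \<longrightarrow> f (k T) \<in> U"
    proof
      \<comment> \<open>The preimage of \<open>U\<close> is itself an index, and any smaller
        \<open>T\<close> contains \<open>k T\<close>.\<close>
      show "{p \<in> topspace (prod_topology X X). f p \<in> U} \<in> I"
        using openin_continuous_map_preimage[OF f, of U] U xy by (simp add: I_def)
    qed (use k in blast)
  qed
  have "net_converges X I (\<lambda>S T. T \<subseteq> S) (\<lambda>T. fst (k T)) x"
    using conv[OF continuous_map_fst] by simp
  moreover have "net_converges X I (\<lambda>S T. T \<subseteq> S) (\<lambda>T. snd (k T)) y"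
    using conv[OF continuous_map_snd] by simp
  moreover have "fst (k T) \<in> topspace X \<and> snd (k T) \<in> topspace X \<and>
      snd (k T) \<in> part_of \<F> (fst (k T))" if "T \<in> I" for T
    using k[OF that] by (auto simp: part_graph_def case_prod_unfold)
  ultimately have "prolongation_nets X \<F> x y I (\<lambda>S T. T \<subseteq> S) (\<lambda>T. fst (k T)) (\<lambda>T. snd (k T))"
    unfolding prolongation_nets_def by (intro conjI dir ballI) simp_all
  then show "y \<in> prolongation X \<F> x"
    by (rule prolongationI)
qed

text \<open>Under characteristic 0 the set in \<open>R_closed\<close> and the closure of
  \<open>part_graph\<close> have the same fibre over every point of the space.\<close>

lemma characteristic_0_imp_R_closed:
  assumes "characteristic_0 X \<F>"
  shows "R_closed X \<F>"
proof -
  let ?G = "prod_topology X X closure_of part_graph X \<F>"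
  have "y \<in> X closure_of part_of \<F> x \<longleftrightarrow> (x, y) \<in> ?G" if "x \<in> topspace X" for x y
    using assms that unfolding characteristic_0_def
    by (simp add: prolongation_iff_closure_part_graph)
  moreover have "?G \<subseteq> topspace X \<times> topspace X"
    using closure_of_subset_topspace[of "prod_topology X X"] by simp
  ultimately have
    "{(x, y). x \<in> topspace X \<and> y \<in> topspace X \<and> y \<in> X closure_of part_of \<F> x} = ?G"
    by blast
  then show ?thesis
    unfolding R_closed_def by simp
qed

text \<open>The point \<open>x\<close> itself serves as \<open>x'\<close> for every neighbourhood
  \<open>U\<close>; in terms of nets, the first net is constant.\<close>

lemma closure_part_of_subset_prolongation:
  assumes "x \<in> topspace X"
  shows "X closure_of part_of \<F> x \<subseteq> prolongation X \<F> x"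
proof
  fix y assume y: "y \<in> X closure_of part_of \<F> x"
  have "\<exists>x'\<in>U. \<exists>y'\<in>V. y' \<in> part_of \<F> x'"
    if "x \<in> U" "openin X V" "y \<in> V" for U V
    using y that unfolding in_closure_of by meson
  moreover have "y \<in> topspace X"
    using y by (simp add: in_closure_of)
  ultimately show "y \<in> prolongation X \<F> x"
    using assms by (simp add: prolongation_iff_closure_part_graph closure_part_graph_iff)
qed

text \<open>An infimum below \<epsilon> forces an admissible radius \<eta> below \<epsilon>, even if
  the infimum is not attained.\<close>

lemma Hausdorff_distance_lessD:
  assumes "Hausdorff_distance M d A B < ereal \<epsilon>" "a \<in> A"
  obtains b where "b \<in> B" "d a b < \<epsilon>"
proof -
  obtain \<eta> where "ereal \<eta> < ereal \<epsilon>" "A \<subseteq> neighbourhood_of_radius M d \<eta> B"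
    using assms(1) unfolding Hausdorff_distance_def Inf_less_iff by blast
  with assms(2) that show thesis
    unfolding neighbourhood_of_radius_def by fastforce
qed

lemma weakly_equicontinuous_imp_characteristic_0:
  assumes "partition_on (topspace X) \<F>" "weakly_equicontinuous X \<F>"
  shows "characteristic_0 X \<F>"
proof -
  obtain d where d: "Metric_space (topspace X) d" "Metric_space.mtopology (topspace X) d = X"
    and eq: "\<forall>\<epsilon>>0. \<exists>\<delta>>0. \<forall>x \<in> topspace X. \<forall>y \<in> topspace X. d x y < \<delta> \<longrightarrow>
          Hausdorff_distance (topspace X) d (part_of \<F> x) (part_of \<F> y) < ereal \<epsilon>"
    using assms(2) unfolding weakly_equicontinuous_def by blast
  interpret Metric_space "topspace X" d by fact
  have ball: "openin X (mball a r)" for a r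
    using openin_mball[of a r] d(2) by simp
  have "y \<in> X closure_of part_of \<F> x" if "y \<in> prolongation X \<F> x" for x y
  proof -
    have xy: "x \<in> topspace X" "y \<in> topspace X"
      and nbhds: "\<And>U V. openin X U \<Longrightarrow> x \<in> U \<Longrightarrow> openin X V \<Longrightarrow> y \<in> V \<Longrightarrow>
        \<exists>x'\<in>U. \<exists>y'\<in>V. y' \<in> part_of \<F> x'"
      using that unfolding prolongation_iff_closure_part_graph closure_part_graph_iff by blast+
    have "\<exists>z\<in>part_of \<F> x. z \<in> mball y r" if "r > 0" for r
    proof -
      \<comment> \<open>Half of \<open>r\<close> is spent on the Hausdorff distance, the other half
        on the distance from \<open>y\<close> to \<open>y'\<close>.\<close>
      obtain \<delta> where \<delta>: "\<delta> > 0"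
        "\<And>u v. u \<in> topspace X \<Longrightarrow> v \<in> topspace X \<Longrightarrow> d u v < \<delta> \<Longrightarrow>
          Hausdorff_distance (topspace X) d (part_of \<F> u) (part_of \<F> v) < ereal (r / 2)"
        using eq \<open>r > 0\<close> half_gt_zero by metis
      obtain x' y' where x': "x' \<in> mball x \<delta>" and y': "y' \<in> mball y (r / 2)" "y' \<in> part_of \<F> x'"
        using nbhds[OF ball _ ball, of x \<delta> y "r / 2"] xy \<delta>(1) \<open>r > 0\<close> by auto
      \<comment> \<open>The part of \<open>x'\<close> comes first because it contains
        \<open>y'\<close>, the point to be approximated from the part of \<open>x\<close>.\<close>
      have "Hausdorff_distance (topspace X) d (part_of \<F> x') (part_of \<F> x) < ereal (r / 2)"
        using x' xy by (intro \<delta>(2)) (auto simp: commute)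
      then obtain z where z: "z \<in> part_of \<F> x" "d y' z < r / 2"
        using y'(2) by (rule Hausdorff_distance_lessD)
      \<comment> \<open>Both the triangle inequality and membership in \<open>mball\<close> require
        points of the carrier.\<close>
      moreover have "z \<in> topspace X"
        using z(1) part_of_subset[OF assms(1) xy(1)] by blast
      moreover have "d y z < r"
        using triangle[of y y' z] y'(1) z(2) \<open>z \<in> topspace X\<close> by auto
      ultimately show ?thesis
        using xy by auto
    qed
    with xy show ?thesis
      using metric_closure_of[of "part_of \<F> x"] d(2) by auto
  qed
  then show ?thesis
    unfolding characteristic_0_def
    by (intro ballI equalityI closure_part_of_subset_prolongation subsetI)
qed

theorem corollary3p4:
  fixes X :: "'a topology" and n :: nat and \<A> :: "('a, 'z) foliated_chart set"
  assumes "foliated_space X n \<A>"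
    and "weakly_equicontinuous X (leaves X \<A>)"
  shows "R_closed X (leaves X \<A>) \<and> characteristic_0 X (leaves X \<A>)"
  using weakly_equicontinuous_imp_characteristic_0[OF partition_on_leaves[OF assms(1)] assms(2)]
  by (simp add: characteristic_0_imp_R_closed)

end
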